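(* Let $n\ge 1$ be an integer, $B>0$, and let $w_1,\ldots,w_n>0$ and $\tau_1,\ldots,\tau_n>0$ be real numbers. The optimal value of the heterogeneous hard-mastery model equals the optimal value of the $0$–$1$ knapsack problem with item values $w_i$, item weights $\tau_i$ and capacity $B$; that is, $$\max_{\mathbf{x}\in\mathcal{B}_B}\ \sum_{i=1}^n w_i\,\mathbf{1}\{x_i\ge\tau_i\}\;=\;\max\Bigl\{\sum_{i=1}^n w_i y_i:\ y_i\in\{0,1\}\text{ for all } i,\ \sum_{i=1}^n\tau_i y_i\le B\Bigr\}.$$
   Context: For $B>0$, $\mathcal{B}_B=\{\mathbf{x}\in[0,\infty)^n:\sum_{i=1}^n x_i=B\}$. In the heterogeneous hard-mastery model, skill $i$ is worth $w_i$ once at least $\tau_i$ units of practice are invested in it ($x_i\ge\tau_i$) and is worth nothing otherwise; the total value of an allocation $\mathbf{x}\in\mathcal{B}_B$ is $\sum_{i} w_i\mathbf{1}\{x_i\ge\tau_i\}$, where $\mathbf{1}\{\cdot\}$ is the $0/1$ indicator. *)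

theory Defs
  imports "HOL-Analysis.Finite_Cartesian_Product"
begin

text \<open>The dimension \<open>n \<ge> 1\<close> is the cardinality of the finite index type \<open>'n\<close>.\<close>

definition budget_simplex :: "real \<Rightarrow> (real ^ 'n::finite) set" where
  "budget_simplex B = {x. (\<forall>i. 0 \<le> x $ i) \<and> (\<Sum>i\<in>UNIV. x $ i) = B}"

definition hard_mastery_value :: "real ^ 'n::finite \<Rightarrow> real ^ 'n \<Rightarrow> real ^ 'n \<Rightarrow> real" where
  "hard_mastery_value w \<tau> x = (\<Sum>i\<in>UNIV. w $ i * of_bool (x $ i \<ge> \<tau> $ i))"

definition knapsack_feasible :: "real ^ 'n::finite \<Rightarrow> real \<Rightarrow> (real ^ 'n) set" where
  "knapsack_feasible \<tau> B = {y. (\<forall>i. y $ i \<in> {0, 1}) \<and> (\<Sum>i\<in>UNIV. \<tau> $ i * y $ i) \<le> B}"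

definition knapsack_value :: "real ^ 'n::finite \<Rightarrow> real ^ 'n \<Rightarrow> real" where
  "knapsack_value w y = (\<Sum>i\<in>UNIV. w $ i * y $ i)"

text \<open>
  The sets of values attained by the two problems. Their \<open>Max\<close> is a genuine maximum only
  if they are finite and nonempty, which therefore has to be established separately.
\<close>

definition hard_mastery_values :: "real ^ 'n::finite \<Rightarrow> real ^ 'n \<Rightarrow> real \<Rightarrow> real set" where
  "hard_mastery_values w \<tau> B = hard_mastery_value w \<tau> ` budget_simplex B"

definition knapsack_values :: "real ^ 'n::finite \<Rightarrow> real ^ 'n \<Rightarrow> real \<Rightarrow> real set" where
  "knapsack_values w \<tau> B = knapsack_value w ` knapsack_feasible \<tau> B"

end

theory Submission
  imports Defs
begin

text \<open>
  The mastered skills of an allocation form a feasible knapsack selection of the same value, so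
  every hard-mastery value is a knapsack value. Conversely, paying exactly \<open>\<tau>\<^sub>i\<close> for
  each selected item and spreading the leftover budget evenly gives an allocation that masters
  at least the selected skills.
\<close>

text \<open>A 0/1 vector is the indicator of its set of 1-coordinates, and a finite index type has
  only finitely many subsets. Finiteness of both value sets rests on this.\<close>

lemma finite_knapsack_feasible: "finite (knapsack_feasible \<tau> B)"
proof (rule finite_subset)
  show "knapsack_feasible \<tau> B \<subseteq> range (\<lambda>S. \<chi> i. of_bool (i \<in> S))"
  proof
    fix y assume "y \<in> knapsack_feasible \<tau> B"
    then have "y = (\<chi> i. of_bool (i \<in> {i. y $ i = 1}))"
      by (auto simp: knapsack_feasible_def vec_eq_iff)
    then show "y \<in> range (\<lambda>S. \<chi> i. of_bool (i \<in> S))" by blast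
  qed
qed simp

lemma zero_mem_knapsack_feasible: "B \<ge> 0 \<Longrightarrow> 0 \<in> knapsack_feasible \<tau> B"
  by (simp add: knapsack_feasible_def)

lemma hard_mastery_values_subset:
  "hard_mastery_values w \<tau> B \<subseteq> knapsack_values w \<tau> B"
proof
  fix v assume "v \<in> hard_mastery_values w \<tau> B"
  then obtain x where x: "\<And>i. 0 \<le> x $ i" "(\<Sum>i\<in>UNIV. x $ i) = B"
    and v: "v = hard_mastery_value w \<tau> x"
    by (auto simp: hard_mastery_values_def budget_simplex_def)
  define y where "y = (\<chi> i. (of_bool (x $ i \<ge> \<tau> $ i) :: real))"
  \<comment> \<open>Termwise: a mastered skill costs \<open>\<tau> $ i\<close>, at most
    \<open>x $ i\<close>; any other costs 0, and \<open>x $ i\<close> is nonnegative.\<close>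
  have "(\<Sum>i\<in>UNIV. \<tau> $ i * y $ i) \<le> (\<Sum>i\<in>UNIV. x $ i)"
    using x(1) by (intro sum_mono) (simp add: y_def of_bool_def)
  then have "y \<in> knapsack_feasible \<tau> B"
    using x(2) by (simp add: knapsack_feasible_def y_def)
  moreover have "v = knapsack_value w y"
    by (simp add: v y_def hard_mastery_value_def knapsack_value_def)
  ultimately show "v \<in> knapsack_values w \<tau> B"
    by (auto simp: knapsack_values_def)
qed

text \<open>Only an inequality can be expected: the spread leftover may lift an unselected skill
  over its threshold and so add value.\<close>

lemma knapsack_value_dominated:
  fixes w \<tau> y :: "real ^ 'n::finite"
  assumes w: "\<And>i. w $ i \<ge> 0" and \<tau>: "\<And>i. \<tau> $ i \<ge> 0" and y: "y \<in> knapsack_feasible \<tau> B"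
  obtains x where "x \<in> budget_simplex B" "knapsack_value w y \<le> hard_mastery_value w \<tau> x"
proof
  \<comment> \<open>The equal share of the unspent budget; the \<open>CARD('n')\<close> shares bring
    the total to exactly \<open>B\<close>, and feasibility of \<open>y\<close> makes
    \<open>r\<close> nonnegative.\<close>
  define r where "r = (B - (\<Sum>i\<in>UNIV. \<tau> $ i * y $ i)) / real CARD('n)"
  define x where "x = (\<chi> i. \<tau> $ i * y $ i + r)"
  have y01: "y $ i = 0 \<or> y $ i = 1" for i
    using y by (auto simp: knapsack_feasible_def)
  have r: "r \<ge> 0"
    using y by (simp add: r_def knapsack_feasible_def)
  have "0 \<le> x $ i" for i
    using y01[of i] \<tau>[of i] r by (auto simp: x_def)
  moreover have "(\<Sum>i\<in>UNIV. x $ i) = B"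
    by (simp add: x_def sum.distrib r_def)
  ultimately show "x \<in> budget_simplex B"
    by (simp add: budget_simplex_def)
  \<comment> \<open>If \<open>y $ i = 1\<close>, then \<open>x $ i = \<tau> $ i + r\<close> reaches
    the threshold and the sides agree; if \<open>y $ i = 0\<close>, the left side vanishes.\<close>
  have "w $ i * y $ i \<le> w $ i * of_bool (x $ i \<ge> \<tau> $ i)" for i
    using y01[of i] w[of i] r by (auto simp: x_def)
  then show "knapsack_value w y \<le> hard_mastery_value w \<tau> x"
    unfolding knapsack_value_def hard_mastery_value_def by (intro sum_mono)
qed

theorem proposition6p1:
  fixes B :: real and w \<tau> :: "real ^ 'n::finite"
  assumes "B > 0" and "\<And>i. w $ i > 0" and "\<And>i. \<tau> $ i > 0"
  shows "finite (hard_mastery_values w \<tau> B) \<and> hard_mastery_values w \<tau> B \<noteq> {} \<and>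
         finite (knapsack_values w \<tau> B) \<and> knapsack_values w \<tau> B \<noteq> {} \<and>
         Max (hard_mastery_values w \<tau> B) = Max (knapsack_values w \<tau> B)"
proof -
  let ?H = "hard_mastery_values w \<tau> B" and ?K = "knapsack_values w \<tau> B"
  have finK: "finite ?K"
    by (simp add: knapsack_values_def finite_knapsack_feasible)
  have finH: "finite ?H"
    by (rule finite_subset[OF hard_mastery_values_subset finK])
  \<comment> \<open>Domination replaces the inclusion of \<open>?K\<close> in \<open>?H\<close>,
    which can fail: with an ample budget, 0 is in \<open>?K\<close> but need not be in
    \<open>?H\<close>.\<close>
  have dom: "\<exists>h\<in>?H. k \<le> h" if "k \<in> ?K" for k
  proof -
    from that obtain y where y: "y \<in> knapsack_feasible \<tau> B" and k: "k = knapsack_value w y"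
      by (auto simp: knapsack_values_def)
    obtain x where "x \<in> budget_simplex B" "k \<le> hard_mastery_value w \<tau> x"
      using knapsack_value_dominated[OF less_imp_le[OF assms(2)] less_imp_le[OF assms(3)] y]
      unfolding k .
    then show ?thesis
      unfolding hard_mastery_values_def by (rule bexI[rotated, OF imageI])
  qed
  have K: "?K \<noteq> {}"
    using zero_mem_knapsack_feasible[of B \<tau>] assms(1) by (auto simp: knapsack_values_def)
  then obtain k where "k \<in> ?K" by blast
  from dom[OF this] have H: "?H \<noteq> {}" by auto
  have "Max ?K \<le> Max ?H"
    using dom[OF Max_in[OF finK K]] finH H by (simp add: Max_ge_iff)
  then have "Max ?H = Max ?K"
    by (rule antisym[OF Max_mono[OF hard_mastery_values_subset H finK]])
  then show ?thesis
    by (intro conjI finH H finK K)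
qed

end
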